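(* $$\sum_{\pi\in T_{2n+1}}\mathrm{sign}(\pi)\, q^{\mathrm{ldes}(\pi)} = \sum_{\pi\in T_n} q^{2\,\mathrm{ldes}(\pi)}\qquad\text{for all } n\ge 0,$$ $$\sum_{\pi\in T_{2n}}\mathrm{sign}(\pi)\, q^{\mathrm{ldes}(\pi)} = (1-q)\sum_{\pi\in T_n} q^{2\,\mathrm{ldes}(\pi)}\qquad\text{for all } n\ge 1.$$
   Context: $S_n$ is the symmetric group on $\{1,\dots,n\}$, and $T_n$ is the set of $321$-avoiding permutations: all $\pi\in S_n$ for which there are no $i<j<k$ with $\pi(i)>\pi(j)>\pi(k)$. For $\pi\in T_n$, $\mathrm{ldes}(\pi)=\max\{1\le i\le n-1 \mid \pi(i)>\pi(i+1)\}$, with $\mathrm{ldes}(\mathrm{id}):=0$; $\mathrm{sign}(\pi)=(-1)^{\mathrm{inv}(\pi)}$, where $\mathrm{inv}(\pi)$ is the number of inversions of $\pi$. For $n=0$ the sum $\sum_{\pi\in T_0}q^{2\,\mathrm{ldes}(\pi)}$ is by convention equal to $1$ (only the empty permutation, with $\mathrm{ldes}=0$). Here $q$ is an indeterminate. *)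

theory Defs
  imports
    "HOL-Combinatorics.Permutations"
    "HOL-Computational_Algebra.Polynomial"
begin

text \<open>Elements of the symmetric group on \<open>{1..n}\<close> are functions \<open>p :: nat \<Rightarrow> nat\<close> with
  \<open>p permutes {1..n}\<close>, i.e. bijections of \<open>nat\<close> fixing every point outside \<open>{1..n}\<close>. In particular,
  for \<open>n = 0\<close> the empty permutation is represented by \<open>id\<close>.\<close>

definition avoids_321 :: "nat \<Rightarrow> (nat \<Rightarrow> nat) \<Rightarrow> bool" where
  "avoids_321 n p \<longleftrightarrow>
     \<not> (\<exists>i\<in>{1..n}. \<exists>j\<in>{1..n}. \<exists>k\<in>{1..n}. i < j \<and> j < k \<and> p i > p j \<and> p j > p k)"

definition T :: "nat \<Rightarrow> (nat \<Rightarrow> nat) set" where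
  "T n = {p. p permutes {1..n} \<and> avoids_321 n p}"

text \<open>A permutation of \<open>{1..n}\<close> other than the identity has a descent, so \<open>Max\<close> is applied to a
  nonempty finite set.\<close>

definition ldes :: "nat \<Rightarrow> (nat \<Rightarrow> nat) \<Rightarrow> nat" where
  "ldes n p = (if p = id then 0 else Max {i. 1 \<le> i \<and> i \<le> n - 1 \<and> p i > p (i + 1)})"

definition inversions :: "nat \<Rightarrow> (nat \<Rightarrow> nat) \<Rightarrow> nat" where
  "inversions n p = card {(i, j). i \<in> {1..n} \<and> j \<in> {1..n} \<and> i < j \<and> p i > p j}"

text \<open>\<open>inv_sign\<close> takes values in the coefficient ring of the generating functions.\<close>

definition inv_sign :: "nat \<Rightarrow> (nat \<Rightarrow> nat) \<Rightarrow> int" where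
  "inv_sign n p = (-1) ^ inversions n p"

abbreviation q :: "int poly" where
  "q \<equiv> [:0, 1:]"

end

theory Submission
  imports Defs
begin

text \<open>Build \<open>T (n + 1)\<close> from \<open>T n\<close> by inserting the value \<open>n + 1\<close> at some position \<open>k\<close> of the
  one-line notation of \<open>p\<close>. A new 321-pattern must start with \<open>n + 1\<close>, so the result avoids 321 iff
  \<open>p\<close> increases from position \<open>k\<close> on, i.e. iff \<open>k\<close> exceeds \<open>ldes n p\<close>. The new last descent is then
  at \<open>k\<close>, except that appending at the end (\<open>k = n + 1\<close>) leaves it where it was; and the insertion
  creates \<open>n + 1 - k\<close> inversions. Both statistics of the result thus depend on \<open>p\<close> only through its
  own statistics.

  Let \<open>A s n e\<close> be the sum of \<open>s ^ inversions n p\<close> over the \<open>p\<close> in \<open>T n\<close> with last descent \<open>e\<close>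
  (called \<open>inv_count s n e\<close> below). The insertion gives the recurrence (lemma \<open>inv_count_Suc\<close>),
  for \<open>e \<le> n\<close>,

    \<open>A s (n + 1) e = A s n e + s ^ (n + 1 - e) * (\<Sum>d<e. A s n d)\<close>.

  At \<open>s = 1\<close> this says that the unsigned numbers are partial sums of the previous row. At \<open>s = - 1\<close>
  two consecutive steps imitate a single unsigned step: an odd row \<open>2 * n + 1\<close> is the unsigned row
  \<open>n\<close> with zeros interleaved, its partial sums turn it into row \<open>2 * n + 2\<close>, in which
  each entry \<open>b\<close> of the unsigned row \<open>n + 1\<close> appears as the pair \<open>b, - b\<close>; in the next step these
  pairs cancel in the partial sums, and the zeros come back (lemma \<open>signed_count\<close>). Interleaved zeros
  substitute \<open>q\<^sup>2\<close> for \<open>q\<close> in the generating function, and the pairs \<open>b, - b\<close> contribute the extra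
  factor \<open>1 - q\<close>.\<close>

section \<open>The last descent\<close>

lemma permutes_increasing_imp_id:
  assumes p: "p permutes {1..n::nat}"
    and inc: "\<And>i. 1 \<le> i \<Longrightarrow> i < n \<Longrightarrow> p i < p (i + 1)"
  shows "p = id"
proof (rule permutes_natset_ge[OF p])
  have "i \<le> p i" if "1 \<le> i" "i \<le> n" for i
    using that
  proof (induction i rule: nat_induct_at_least)
    case base
    then show ?case using permutes_in_image[OF p, of 1] by simp
  next
    case (Suc i)
    then show ?case using inc[of i] by simp
  qed
  then show "\<forall>i\<in>{1..n}. i \<le> p i" by simp
qed

lemma permutes_neq_Suc:
  assumes "(p :: nat \<Rightarrow> nat) permutes S"
  shows "p i \<noteq> p (i + 1)"
  using inj_eq[OF permutes_inj[OF assms], of i "i + 1"] by simp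

text \<open>The clause \<open>d = 0\<close> covers the identity: a permutation without descents is increasing, hence
  the identity, so the exceptional value in the definition of \<open>ldes\<close> is consistent with this
  description.\<close>

lemma ldes_eqI:
  assumes p: "p permutes {1..n}"
    and desc: "d = 0 \<or> (1 \<le> d \<and> d < n \<and> p d > p (d + 1))"
    and inc: "\<And>i. d < i \<Longrightarrow> i < n \<Longrightarrow> p i < p (i + 1)"
  shows "ldes n p = d"
proof (cases "p = id")
  case True
  then show ?thesis using desc by (auto simp: ldes_def)
next
  case False
  let ?D = "{i. 1 \<le> i \<and> i \<le> n - 1 \<and> p i > p (i + 1)}"
  have "d \<noteq> 0" using permutes_increasing_imp_id[OF p] inc False by fastforce
  with desc have "d \<in> ?D" by auto
  moreover have "i \<le> d" if "i \<in> ?D" for i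
    using that inc[of i] by (cases "d < i"; cases "i < n") auto
  moreover have "finite ?D" by (rule finite_subset[of _ "{..n}"]) auto
  ultimately have "Max ?D = d" by (intro Max_eqI) auto
  then show ?thesis using False by (simp add: ldes_def)
qed

text \<open>The two properties that determine \<open>ldes\<close> by the previous lemma always hold, so
  that arguments about last descents need not refer to \<open>Max\<close>.\<close>

lemma ldes_spec:
  assumes p: "p permutes {1..n}"
  shows "ldes n p = 0 \<or> (1 \<le> ldes n p \<and> ldes n p < n \<and> p (ldes n p) > p (ldes n p + 1))"
    and "\<And>i. ldes n p < i \<Longrightarrow> i < n \<Longrightarrow> p i < p (i + 1)"
proof -
  let ?D = "{i. 1 \<le> i \<and> i < n \<and> p i > p (i + 1)}"
  have fin: "finite ?D" by (rule finite_subset[of _ "{..n}"]) auto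
  have "\<exists>d. (d = 0 \<or> (1 \<le> d \<and> d < n \<and> p d > p (d + 1))) \<and>
             (\<forall>i. d < i \<longrightarrow> i < n \<longrightarrow> p i < p (i + 1))"
  proof (cases "?D = {}")
    case True
    have "p i < p (i + 1)" if "0 < i" "i < n" for i
    proof -
      from True have "i \<notin> ?D" by blast
      then show ?thesis using that permutes_neq_Suc[OF p, of i] by auto
    qed
    then show ?thesis by blast
  next
    case False
    have "p i < p (i + 1)" if "Max ?D < i" "i < n" for i
    proof -
      have "i \<notin> ?D" using Max_ge[OF fin, of i] that by linarith
      then show ?thesis using that permutes_neq_Suc[OF p, of i] by auto
    qed
    then show ?thesis using Max_in[OF fin False] by blast
  qed
  then obtain d where d: "d = 0 \<or> (1 \<le> d \<and> d < n \<and> p d > p (d + 1))"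
    "\<And>i. d < i \<Longrightarrow> i < n \<Longrightarrow> p i < p (i + 1)" by blast
  have eq: "ldes n p = d" by (rule ldes_eqI[OF p d])
  show "ldes n p = 0 \<or> (1 \<le> ldes n p \<and> ldes n p < n \<and> p (ldes n p) > p (ldes n p + 1))"
    unfolding eq by (rule d(1))
  show "p i < p (i + 1)" if "ldes n p < i" "i < n" for i
    using that unfolding eq by (rule d(2))
qed

lemma ldes_less_iff_increasing:
  assumes p: "p permutes {1..n}" and k: "1 \<le> k"
  shows "ldes n p < k \<longleftrightarrow> (\<forall>i j. k \<le> i \<longrightarrow> i < j \<longrightarrow> j \<le> n \<longrightarrow> p i < p j)"
proof
  assume less: "ldes n p < k"
  show "\<forall>i j. k \<le> i \<longrightarrow> i < j \<longrightarrow> j \<le> n \<longrightarrow> p i < p j"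
  proof (intro allI impI)
    fix i j assume ki: "k \<le> i" and ij: "i < j" and "j \<le> n"
    from ij have "Suc i \<le> j" by simp
    then show "p i < p j" using \<open>j \<le> n\<close>
    proof (induction j rule: dec_induct)
      case base
      then show ?case using ldes_spec(2)[OF p, of i] less ki by simp
    next
      case (step m)
      then show ?case using ldes_spec(2)[OF p, of m] less ki by simp
    qed
  qed
next
  assume inc: "\<forall>i j. k \<le> i \<longrightarrow> i < j \<longrightarrow> j \<le> n \<longrightarrow> p i < p j"
  have "\<not> k \<le> ldes n p"
  proof
    assume "k \<le> ldes n p"
    then show False using ldes_spec(1)[OF p] inc k
      by (metis One_nat_def Suc_eq_plus1 Suc_leI lessI not_less_iff_gr_or_eq not_one_le_zero le_0_eq)
  qed
  then show "ldes n p < k" by simp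
qed

section \<open>Inserting the largest value\<close>

text \<open>The order embedding of the old positions into the new ones that leaves out position \<open>k\<close>.\<close>

definition skip :: "nat \<Rightarrow> nat \<Rightarrow> nat" where
  "skip k i = (if i < k then i else i + 1)"

text \<open>The cycle for which the one-line notation of \<open>p \<circ> move_to n k\<close> is that of \<open>p\<close> with the
  value \<open>n + 1\<close> inserted at position \<open>k\<close>: since \<open>p\<close> fixes \<open>n + 1\<close>, position \<open>k\<close> receives the value
  \<open>n + 1\<close>. Composition with a permutation makes the insertion invertible for free.\<close>

definition move_to :: "nat \<Rightarrow> nat \<Rightarrow> nat \<Rightarrow> nat" where
  "move_to n k i = (if i = k then Suc n else if k < i \<and> i \<le> Suc n then i - 1 else i)"

lemma skip_less_iff [simp]: "skip k i < skip k j \<longleftrightarrow> i < j"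
  by (auto simp: skip_def)

lemma skip_eq_iff [simp]: "skip k i = skip k j \<longleftrightarrow> i = j"
  by (auto simp: skip_def)

lemma skip_neq [simp]: "skip k i \<noteq> k" "k \<noteq> skip k i"
  by (auto simp: skip_def)

lemma skip_greater_iff: "k < skip k i \<longleftrightarrow> k \<le> i"
  by (auto simp: skip_def)

lemma atLeastAtMost_Suc_eq_skip:
  assumes "k \<in> {1..Suc n}"
  shows "{1..Suc n} = insert k (skip k ` {1..n})"
proof
  show "{1..Suc n} \<subseteq> insert k (skip k ` {1..n})"
  proof
    fix x assume x: "x \<in> {1..Suc n}"
    consider "x = k" | "x < k" | "k < x" by linarith
    then show "x \<in> insert k (skip k ` {1..n})"
    proof cases
      case 2
      then have "x = skip k x" "x \<in> {1..n}" using x assms by (auto simp: skip_def)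
      then show ?thesis by blast
    next
      case 3
      then have "x = skip k (x - 1)" "x - 1 \<in> {1..n}" using x assms by (auto simp: skip_def)
      then show ?thesis by blast
    qed simp
  qed
qed (use assms in \<open>auto simp: skip_def\<close>)

lemma move_to_permutes:
  assumes "k \<in> {1..Suc n}"
  shows "move_to n k permutes {1..Suc n}"
proof (rule bij_imp_permutes)
  have "inj_on (move_to n k) {1..Suc n}" using assms
    by (auto simp: inj_on_def move_to_def split: if_splits)
  moreover have "move_to n k ` {1..Suc n} \<subseteq> {1..Suc n}" using assms
    by (auto simp: move_to_def)
  ultimately show "bij_betw (move_to n k) {1..Suc n} {1..Suc n}"
    by (simp add: bij_betw_def endo_inj_surj)
qed (use assms in \<open>auto simp: move_to_def\<close>)

lemma move_to_last: "move_to n (Suc n) = id"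
  by (auto simp: move_to_def)

locale max_insertion =
  fixes n k :: nat and p :: "nat \<Rightarrow> nat"
  assumes p: "p permutes {1..n}" and k: "k \<in> {1..Suc n}"
begin

definition ins :: "nat \<Rightarrow> nat" where "ins = p \<circ> move_to n k"

lemma ins_permutes: "ins permutes {1..Suc n}"
  unfolding ins_def
  by (rule permutes_compose[OF move_to_permutes[OF k] permutes_subset[OF p]]) simp

lemma ins_at: "ins k = Suc n"
  using permutes_not_in[OF p, of "Suc n"] by (simp add: ins_def move_to_def)

lemma ins_skip: "i \<in> {1..n} \<Longrightarrow> ins (skip k i) = p i"
  by (auto simp: ins_def move_to_def skip_def)

lemma p_le: "i \<in> {1..n} \<Longrightarrow> p i \<le> n"
  using permutes_in_image[OF p, of i] by simp

text \<open>As the largest value, \<open>n + 1\<close> can only be the first entry of a 321-pattern; it is one iff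
  some descending pair of \<open>p\<close> lies at positions from \<open>k\<close> on.\<close>

lemma ins_avoids_iff: "avoids_321 (Suc n) ins \<longleftrightarrow> avoids_321 n p \<and> ldes n p < k"
proof -
  have le: "\<not> Suc n < p i" "p i < Suc n" if "i \<in> {1..n}" for i using p_le[OF that] by auto
  have "avoids_321 (Suc n) ins \<longleftrightarrow>
      avoids_321 n p \<and> (\<forall>i\<in>{1..n}. \<forall>j\<in>{1..n}. k \<le> i \<longrightarrow> i < j \<longrightarrow> \<not> p j < p i)"
    unfolding avoids_321_def atLeastAtMost_Suc_eq_skip[OF k]
    by (auto simp: ins_at ins_skip le skip_greater_iff simp del: atLeastAtMost_iff)
  also have "(\<forall>i\<in>{1..n}. \<forall>j\<in>{1..n}. k \<le> i \<longrightarrow> i < j \<longrightarrow> \<not> p j < p i) \<longleftrightarrow>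
      (\<forall>i j. k \<le> i \<longrightarrow> i < j \<longrightarrow> j \<le> n \<longrightarrow> p i < p j)" (is "?L \<longleftrightarrow> ?R")
  proof
    assume L: ?L
    show ?R
    proof (intro allI impI)
      fix i j assume "k \<le> i" "i < j" "j \<le> n"
      moreover from this have "\<not> p j < p i" using L k by simp
      moreover have "p i \<noteq> p j" using \<open>i < j\<close> inj_eq[OF permutes_inj[OF p], of i j] by simp
      ultimately show "p i < p j" by simp
    qed
  next
    assume ?R
    then show ?L by (auto dest: less_not_sym)
  qed
  also have "\<dots> \<longleftrightarrow> ldes n p < k" using ldes_less_iff_increasing[OF p] k by simp
  finally show ?thesis .
qed

text \<open>For \<open>k \<le> n\<close> the new maximum is followed by something smaller, and everything after it is an
  increasing tail of \<open>p\<close>. For \<open>k = n + 1\<close> the maximum is appended and adds only an ascent.\<close>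

lemma ldes_ins:
  assumes "ldes n p < k"
  shows "ldes (Suc n) ins = (if k = Suc n then ldes n p else k)"
proof (cases "k = Suc n")
  case True
  then have "p \<circ> move_to n k = p" by (simp add: move_to_last)
  then have ins: "ins = p" by (simp only: ins_def)
  have "p i < p (i + 1)" if "ldes n p < i" "i < Suc n" for i
  proof (cases "i = n")
    case True
    then show ?thesis using p_le[of n] that permutes_not_in[OF p, of "Suc n"] by auto
  next
    case False
    then show ?thesis using ldes_spec(2)[OF p, of i] that by simp
  qed
  then have "ldes (Suc n) ins = ldes n p"
    using ldes_spec(1)[OF p] ins ins_permutes by (intro ldes_eqI) auto
  then show ?thesis using True by simp
next
  case False
  then have kn: "1 \<le> k" "k \<le> n" using k by auto
  have shift: "ins (i + 1) = p i" if "k \<le> i" "i \<le> n" for i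
    using ins_skip[of i] that kn by (simp add: skip_def)
  have "ldes (Suc n) ins = k"
  proof (rule ldes_eqI[OF ins_permutes])
    show "k = 0 \<or> 1 \<le> k \<and> k < Suc n \<and> ins (k + 1) < ins k"
      using kn shift[of k] ins_at p_le[of k] by simp
    fix i assume i: "k < i" "i < Suc n"
    then have "p (i - 1) < p i" using ldes_spec(2)[OF p, of "i - 1"] assms by simp
    then show "ins i < ins (i + 1)" using shift[of "i - 1"] shift[of i] i by simp
  qed
  then show ?thesis using False by simp
qed

text \<open>Inversions of \<open>p\<close> persist at the shifted positions, and the new maximum forms an inversion
  with each of the \<open>n + 1 - k\<close> positions after it.\<close>

lemma inversions_ins: "inversions (Suc n) ins = inversions n p + (Suc n - k)"
proof -
  let ?I = "{(i, j). i \<in> {1..n} \<and> j \<in> {1..n} \<and> i < j \<and> p i > p j}"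
  let ?J = "{(i, j). i \<in> {1..Suc n} \<and> j \<in> {1..Suc n} \<and> i < j \<and> ins i > ins j}"
  have le: "\<not> Suc n < p i" "p i < Suc n" if "i \<in> {1..n}" for i using p_le[OF that] by auto
  have "?J = map_prod (skip k) (skip k) ` ?I \<union> {k} \<times> {k<..Suc n}" (is "_ = ?U \<union> ?V")
  proof
    show "?J \<subseteq> ?U \<union> ?V"
    proof
      fix x assume "x \<in> ?J"
      then obtain i j where x: "x = (i, j)" and ij: "i \<in> {1..Suc n}" "j \<in> {1..Suc n}"
        "i < j" "ins i > ins j" by blast
      show "x \<in> ?U \<union> ?V"
      proof (cases "i = k")
        case False
        then obtain a where a: "a \<in> {1..n}" "i = skip k a"
          using ij(1) unfolding atLeastAtMost_Suc_eq_skip[OF k] by blast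
        then have "j \<noteq> k" using ij(4) by (auto simp: ins_at ins_skip le simp del: atLeastAtMost_iff)
        then obtain b where b: "b \<in> {1..n}" "j = skip k b"
          using ij(2) unfolding atLeastAtMost_Suc_eq_skip[OF k] by blast
        have "(a, b) \<in> ?I" using ij(3,4) a b ins_skip by auto
        then show ?thesis using x a b by force
      qed (use x ij in auto)
    qed
    have "?U \<subseteq> ?J"
      unfolding atLeastAtMost_Suc_eq_skip[OF k]
      by (auto simp: ins_skip simp del: atLeastAtMost_iff)
    moreover have "?V \<subseteq> ?J"
    proof
      fix x assume "x \<in> ?V"
      then obtain j where x: "x = (k, j)" and j: "k < j" "j \<le> Suc n" by auto
      then have "j \<in> skip k ` {1..n}"
        using atLeastAtMost_Suc_eq_skip[OF k] k by auto
      then have "ins j < ins k" by (auto simp: ins_at ins_skip le simp del: atLeastAtMost_iff)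
      then show "x \<in> ?J" using x j k by auto
    qed
    ultimately show "?U \<union> ?V \<subseteq> ?J" by blast
  qed
  moreover have "card (?U \<union> ?V) = card ?U + card ?V"
  proof (rule card_Un_disjoint)
    show "finite ?U"
      by (rule finite_imageI, rule finite_subset[of _ "{1..n} \<times> {1..n}"]) auto
  qed auto
  moreover have "card ?U = card ?I" by (rule card_image) (auto simp: inj_on_def)
  moreover have "card ?V = Suc n - k" by (simp add: card_cartesian_product)
  ultimately have "card ?J = card ?I + (Suc n - k)" by (simp only:)
  then show ?thesis by (simp add: inversions_def)
qed

end

text \<open>The position of the value \<open>n + 1\<close> in the result recovers \<open>k\<close>, and undoing the cycle then
  recovers \<open>p\<close>.\<close>

lemma bij_betw_insert_max:
  "bij_betw (\<lambda>(p, k). p \<circ> move_to n k) (SIGMA p:T n. {ldes n p<..Suc n}) (T (Suc n))"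
proof (rule bij_betw_imageI)
  have fixed: "p (Suc n) = Suc n" if "p permutes {1..n}" for p
    using permutes_not_in[OF that, of "Suc n"] by simp
  show "inj_on (\<lambda>(p, k). p \<circ> move_to n k) (SIGMA p:T n. {ldes n p<..Suc n})"
  proof (rule inj_onI, clarify)
    fix p k p' k'
    assume A: "p \<in> T n" "p' \<in> T n" "k \<in> {ldes n p<..Suc n}" "k' \<in> {ldes n p'<..Suc n}"
      and eq: "p \<circ> move_to n k = p' \<circ> move_to n k'"
    then have perm: "p permutes {1..n}" "p' permutes {1..n}" by (auto simp: T_def)
    have kk: "k \<in> {1..Suc n}" "k' \<in> {1..Suc n}" using A by auto
    interpret P: max_insertion n k p using perm kk by unfold_locales
    interpret P': max_insertion n k' p' using perm kk by unfold_locales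
    have eq': "P.ins = P'.ins" using eq by (simp add: P.ins_def P'.ins_def)
    have "P.ins k = P.ins k'" using P.ins_at P'.ins_at eq' by simp
    then have "k = k'" using inj_eq[OF permutes_inj[OF P.ins_permutes]] by simp
    moreover have "p = p'"
    proof -
      have "surj (move_to n k)" using permutes_surj[OF move_to_permutes[OF kk(1)]] .
      then show ?thesis using eq \<open>k = k'\<close> by (metis fun.map_id0 comp_assoc surj_iff comp_id)
    qed
    ultimately show "p = p' \<and> k = k'" by simp
  qed
  show "(\<lambda>(p, k). p \<circ> move_to n k) ` (SIGMA p:T n. {ldes n p<..Suc n}) = T (Suc n)"
  proof (intro equalityI subsetI)
    fix s assume "s \<in> (\<lambda>(p, k). p \<circ> move_to n k) ` (SIGMA p:T n. {ldes n p<..Suc n})"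
    then obtain p k where s: "s = p \<circ> move_to n k"
      and pT: "p \<in> T n" and less: "ldes n p < k" and "k \<le> Suc n"
      by auto
    interpret max_insertion n k p by unfold_locales (use pT less \<open>k \<le> Suc n\<close> in \<open>auto simp: T_def\<close>)
    have "avoids_321 (Suc n) ins" using ins_avoids_iff pT less by (simp add: T_def)
    then show "s \<in> T (Suc n)" using ins_permutes unfolding s ins_def T_def by simp
  next
    fix s assume "s \<in> T (Suc n)"
    then have s: "s permutes {1..Suc n}" "avoids_321 (Suc n) s" by (auto simp: T_def)
    define k where "k = inv s (Suc n)"
    have sk: "s k = Suc n" unfolding k_def using permutes_inverses(1)[OF s(1)] by simp
    have k: "k \<in> {1..Suc n}" using sk permutes_in_image[OF s(1), of k] by simp
    note c = move_to_permutes[OF k]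
    define p where "p = s \<circ> inv (move_to n k)"
    have s_eq: "s = p \<circ> move_to n k"
      unfolding p_def by (simp add: comp_assoc permutes_inv_o(2)[OF c])
    have perm: "p permutes {1..Suc n}"
      unfolding p_def by (rule permutes_compose[OF permutes_inv[OF c] s(1)])
    have last: "p (Suc n) = Suc n"
      using sk unfolding s_eq by (simp add: move_to_def)
    have "{1..Suc n} - {1..n} = {Suc n}" by auto
    then have p: "p permutes {1..n}"
      using last by (intro permutes_superset[OF perm]) simp
    interpret max_insertion n k p using p k by unfold_locales
    have "avoids_321 (Suc n) ins" using s(2) s_eq by (simp only: ins_def)
    then have "p \<in> T n" "ldes n p < k" using ins_avoids_iff p by (simp_all add: T_def)
    then show "s \<in> (\<lambda>(p, k). p \<circ> move_to n k) ` (SIGMA p:T n. {ldes n p<..Suc n})"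
      by (intro image_eqI[of _ _ "(p, k)"]) (use s_eq k in auto)
  qed
qed

section \<open>Refined counting\<close>

lemma finite_T: "finite (T n)"
  by (rule finite_subset[OF _ finite_permutations[of "{1..n}"]]) (auto simp: T_def)

text \<open>The inversion enumerator of the permutations with last descent \<open>d\<close>, evaluated at \<open>s\<close>: their
  number for \<open>s = 1\<close> and their signed number for \<open>s = - 1\<close>.\<close>

definition inv_count :: "'a::comm_semiring_1 \<Rightarrow> nat \<Rightarrow> nat \<Rightarrow> 'a" where
  "inv_count s n d = (\<Sum>p | p \<in> T n \<and> ldes n p = d. s ^ inversions n p)"

text \<open>The first summand comes from appending \<open>n + 1\<close> at the end, the second from inserting it at
  position \<open>e\<close>, which is possible exactly for the permutations with last descent below \<open>e\<close>.\<close>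

lemma inv_count_Suc:
  assumes "e \<le> n"
  shows "inv_count s (Suc n) e = inv_count s n e + s ^ (Suc n - e) * (\<Sum>d<e. inv_count s n d)"
proof -
  let ?S = "\<lambda>p. {ldes n p<..Suc n}"
  let ?f = "\<lambda>p k. if (if k = Suc n then ldes n p else k) = e
              then s ^ (inversions n p + (Suc n - k)) else 0"
  have ldes_le: "ldes n p \<le> n" if "p \<in> T n" for p
    using ldes_spec(1)[of p n] that by (auto simp: T_def)
  have "inv_count s (Suc n) e =
      (\<Sum>r\<in>T (Suc n). if ldes (Suc n) r = e then s ^ inversions (Suc n) r else 0)"
    unfolding inv_count_def by (rule sum.inter_filter[OF finite_T])
  also have "\<dots> = (\<Sum>(p, k)\<in>Sigma (T n) ?S. ?f p k)"
  proof (rule sum.reindex_bij_betw[OF bij_betw_insert_max, symmetric, THEN trans],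
      rule sum.cong[OF refl], clarify)
    fix p k assume "p \<in> T n" "k \<in> ?S p"
    then interpret max_insertion n k p by unfold_locales (auto simp: T_def)
    show "(if ldes (Suc n) (p \<circ> move_to n k) = e
        then s ^ inversions (Suc n) (p \<circ> move_to n k) else 0) = ?f p k"
      using ldes_ins inversions_ins \<open>k \<in> ?S p\<close> by (simp add: ins_def)
  qed
  also have "\<dots> = (\<Sum>p\<in>T n. \<Sum>k\<in>?S p. ?f p k)"
    using finite_T by (simp add: sum.Sigma)
  \<comment> \<open>For each \<open>p\<close>, at most two positions give last descent \<open>e\<close>: the end, and \<open>e\<close> itself.\<close>
  also have "\<dots> = (\<Sum>p\<in>T n. (if ldes n p = e then s ^ inversions n p else 0) +
      (if ldes n p < e then s ^ (Suc n - e) * s ^ inversions n p else 0))"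
  proof (rule sum.cong[OF refl])
    fix p assume "p \<in> T n"
    then have "?S p = insert (Suc n) {ldes n p<..n}" using ldes_le by fastforce
    then have "(\<Sum>k\<in>?S p. ?f p k) = ?f p (Suc n) + (\<Sum>k\<in>{ldes n p<..n}. ?f p k)" by simp
    also have "(\<Sum>k\<in>{ldes n p<..n}. ?f p k) =
        (\<Sum>k\<in>{ldes n p<..n}. if k = e then s ^ (inversions n p + (Suc n - e)) else 0)"
      by (rule sum.cong) auto
    also have "\<dots> = (if ldes n p < e then s ^ (Suc n - e) * s ^ inversions n p else 0)"
      using assms by (subst power_add) (simp add: mult.commute)
    finally show "(\<Sum>k\<in>?S p. ?f p k) = (if ldes n p = e then s ^ inversions n p else 0) +
      (if ldes n p < e then s ^ (Suc n - e) * s ^ inversions n p else 0)" by simp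
  qed
  also have "\<dots> = inv_count s n e +
      (\<Sum>p | p \<in> T n \<and> ldes n p < e. s ^ (Suc n - e) * s ^ inversions n p)"
    unfolding inv_count_def sum.distrib by (simp add: sum.inter_filter[OF finite_T])
  also have "(\<Sum>p | p \<in> T n \<and> ldes n p < e. s ^ (Suc n - e) * s ^ inversions n p) =
      s ^ (Suc n - e) * (\<Sum>d<e. inv_count s n d)"
  proof -
    have "(\<Sum>p | p \<in> T n \<and> ldes n p < e. s ^ inversions n p) =
      (\<Sum>d<e. \<Sum>p | p \<in> {p \<in> T n. ldes n p < e} \<and> ldes n p = d. s ^ inversions n p)"
      by (rule sum.group[symmetric]) (auto simp: finite_T)
    also have "\<dots> = (\<Sum>d<e. inv_count s n d)"
      unfolding inv_count_def by (intro sum.cong) auto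
    finally show ?thesis by (simp add: sum_distrib_left[symmetric])
  qed
  finally show ?thesis .
qed

lemma inv_count_0: "inv_count s 0 d = (if d = 0 then 1 else 0)"
proof -
  have "T 0 = {id}" by (auto simp: T_def avoids_321_def)
  then have "{p. p \<in> T 0 \<and> ldes 0 p = d} = (if d = 0 then {id} else {})"
    by (auto simp: ldes_def)
  then show ?thesis by (simp add: inv_count_def inversions_def)
qed

text \<open>Row \<open>0\<close> is excluded because the empty permutation has last descent \<open>0\<close>.\<close>

lemma inv_count_eq_0:
  assumes "1 \<le> n" "n \<le> d"
  shows "inv_count s n d = 0"
proof -
  have "ldes n p \<noteq> d" if "p \<in> T n" for p
    using ldes_spec(1)[of p n] that assms by (auto simp: T_def)
  then have "{p. p \<in> T n \<and> ldes n p = d} = {}" by blast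
  then show ?thesis by (simp add: inv_count_def del: Collect_empty_eq)
qed

text \<open>Any bound \<open>N\<close> above all last descents will do; the freedom lets rows be padded by zeros to
  an even length, so that their entries can be paired up.\<close>

lemma sum_T_eq_sum_inv_count:
  assumes "n \<le> N" "0 < N"
  shows "(\<Sum>p\<in>T n. f (ldes n p) * s ^ inversions n p) = (\<Sum>d<N. f d * inv_count s n d)"
proof -
  have "ldes n p < N" if "p \<in> T n" for p
    using ldes_spec(1)[of p n] that assms by (auto simp: T_def)
  then have "(\<Sum>p\<in>T n. f (ldes n p) * s ^ inversions n p) =
      (\<Sum>d<N. \<Sum>p | p \<in> T n \<and> ldes n p = d. f (ldes n p) * s ^ inversions n p)"
    by (intro sum.group[symmetric]) (auto simp: finite_T)
  also have "\<dots> = (\<Sum>d<N. f d * inv_count s n d)"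
    unfolding inv_count_def by (simp add: sum_distrib_left)
  finally show ?thesis .
qed

section \<open>Signed counts double the unsigned ones\<close>

lemma sum_lessThan_double:
  fixes f :: "nat \<Rightarrow> 'a::comm_monoid_add"
  shows "(\<Sum>d<2 * k. f d) = (\<Sum>d<k. f (2 * d) + f (2 * d + 1))"
  by (induction k) (simp_all add: add.assoc)

lemma count_Suc:
  "e \<le> n \<Longrightarrow> inv_count 1 (Suc n) e = (\<Sum>d\<le>e. inv_count 1 n d)"
  by (simp add: inv_count_Suc lessThan_Suc_atMost[symmetric] add.commute)

context
  fixes s :: "'a::comm_ring_1"
  assumes s: "s = - 1"
begin

text \<open>The zeros at odd places make both \<open>2 * d\<close> and \<open>2 * d + 1\<close> see a partial sum of the unsigned
  row \<open>n\<close>, and the sign \<open>s ^ (2 * n + 2 - e)\<close> alternates with \<open>e\<close>. At \<open>2 * d\<close> the old entry completes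
  the partial sum up to \<open>d - 1\<close> to the one up to \<open>d\<close>; at \<open>2 * d + 1\<close> the sum already includes it.\<close>

lemma signed_count_odd_to_even:
  assumes even: "\<And>d. d \<le> n \<Longrightarrow> inv_count s (2 * n + 1) (2 * d) = inv_count 1 n d"
    and odd: "\<And>d. d \<le> n \<Longrightarrow> inv_count s (2 * n + 1) (2 * d + 1) = 0"
    and d: "d \<le> n"
  shows "inv_count s (2 * n + 2) (2 * d) = inv_count 1 (Suc n) d"
    and "inv_count s (2 * n + 2) (2 * d + 1) = - inv_count 1 (Suc n) d"
proof -
  have half: "(\<Sum>i<2 * k. inv_count s (2 * n + 1) i) = (\<Sum>i<k. inv_count 1 n i)" if "k \<le> Suc n" for k
    unfolding sum_lessThan_double using that by (intro sum.cong) (auto simp: even[simplified] odd[simplified])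
  have "s ^ (2 * n + 2 - 2 * d) = 1"
    using d by (simp add: s uminus_power_if)
  moreover have "s ^ (2 * n + 2 - (2 * d + 1)) = - 1"
    using d by (simp add: s uminus_power_if)
  ultimately show "inv_count s (2 * n + 2) (2 * d) = inv_count 1 (Suc n) d"
    and "inv_count s (2 * n + 2) (2 * d + 1) = - inv_count 1 (Suc n) d"
    using inv_count_Suc[of "2 * d" "2 * n + 1" s] inv_count_Suc[of "2 * d + 1" "2 * n + 1" s]
      half[of d] d even[of d] odd[of d] count_Suc[OF d, where 'a = 'a]
    by (simp_all add: lessThan_Suc_atMost[symmetric] add.commute)
qed

text \<open>Partial sums of a row made of pairs \<open>b, - b\<close> vanish at even places and equal \<open>b\<close> at odd ones.
  So the even entries stay, and the odd entries \<open>- b\<close> are cancelled.\<close>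

lemma signed_count_even_to_odd:
  assumes even: "\<And>d. d \<le> n \<Longrightarrow> inv_count s (2 * n) (2 * d) = inv_count 1 n d"
    and odd: "\<And>d. d \<le> n \<Longrightarrow> inv_count s (2 * n) (2 * d + 1) = - inv_count 1 n d"
    and d: "d \<le> n" and n: "1 \<le> n"
  shows "inv_count s (2 * n + 1) (2 * d) = inv_count 1 n d"
    and "inv_count s (2 * n + 1) (2 * d + 1) = 0"
proof -
  have cancel: "(\<Sum>i<2 * k. inv_count s (2 * n) i) = 0" if "k \<le> Suc n" for k
    unfolding sum_lessThan_double using that by (intro sum.neutral) (auto simp: even odd[simplified])
  show "inv_count s (2 * n + 1) (2 * d) = inv_count 1 n d"
    using inv_count_Suc[of "2 * d" "2 * n" s] cancel[of d] d even[of d] by simp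
  show "inv_count s (2 * n + 1) (2 * d + 1) = 0"
    \<comment> \<open>The recurrence reaches last descents up to \<open>2 * n\<close>; the place \<open>2 * n + 1\<close> is out of range.\<close>
  proof (cases "d = n")
    case True
    then show ?thesis by (intro inv_count_eq_0) auto
  next
    case False
    then have "s ^ (2 * n - 2 * d) = 1" using d by (simp add: s uminus_power_if)
    then show ?thesis
      using inv_count_Suc[of "2 * d + 1" "2 * n" s] cancel[of d] d even[of d] odd[of d] False by simp
  qed
qed

text \<open>The even rows start only at \<open>n = 1\<close>: row \<open>0\<close> has the single entry \<open>1\<close> without a partner
  \<open>- 1\<close>, so the induction starts from row \<open>1\<close>.\<close>

lemma signed_count:
  assumes "d \<le> n"
  shows "inv_count s (2 * n + 1) (2 * d) = inv_count 1 n d"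
    and "inv_count s (2 * n + 1) (2 * d + 1) = 0"
    and "1 \<le> n \<Longrightarrow> inv_count s (2 * n) (2 * d) = inv_count 1 n d"
    and "1 \<le> n \<Longrightarrow> inv_count s (2 * n) (2 * d + 1) = - inv_count 1 n d"
proof -
  let ?odd = "\<lambda>n. \<forall>d\<le>n. inv_count s (2 * n + 1) (2 * d) = inv_count 1 n d \<and>
      inv_count s (2 * n + 1) (2 * d + 1) = 0"
  let ?even = "\<lambda>n. \<forall>d\<le>n. inv_count s (2 * n) (2 * d) = inv_count 1 n d \<and>
      inv_count s (2 * n) (2 * d + 1) = - inv_count 1 n d"
  have step: "?even (Suc n)" if "?odd n" for n
  proof (intro allI impI)
    fix d assume d: "d \<le> Suc n"
    show "inv_count s (2 * Suc n) (2 * d) = inv_count 1 (Suc n) d \<and>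
      inv_count s (2 * Suc n) (2 * d + 1) = - inv_count 1 (Suc n) d"
    proof (cases "d = Suc n")
      case True
      then show ?thesis by (simp add: inv_count_eq_0)
    next
      case False
      then show ?thesis using signed_count_odd_to_even[of n d] that d by simp
    qed
  qed
  have odd: "?odd n" for n
  proof (induction n)
    case 0
    show ?case by (simp add: inv_count_Suc inv_count_0 inv_count_eq_0)
  next
    case (Suc n)
    show ?case using step[OF Suc] signed_count_even_to_odd[of "Suc n"] by simp
  qed
  have "?even n" if "1 \<le> n"
    using step[OF odd, of "n - 1"] that by simp
  with odd[of n] assms show "inv_count s (2 * n + 1) (2 * d) = inv_count 1 n d"
    "inv_count s (2 * n + 1) (2 * d + 1) = 0"
    "1 \<le> n \<Longrightarrow> inv_count s (2 * n) (2 * d) = inv_count 1 n d"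
    "1 \<le> n \<Longrightarrow> inv_count s (2 * n) (2 * d + 1) = - inv_count 1 n d"
    by blast+
qed

end

theorem theorem1p3:
  shows "(\<forall>n\<ge>0. (\<Sum>p\<in>T (2 * n + 1). of_int (inv_sign (2 * n + 1) p) * q ^ ldes (2 * n + 1) p)
                 = (\<Sum>p\<in>T n. q ^ (2 * ldes n p)))
       \<and> (\<forall>n\<ge>1. (\<Sum>p\<in>T (2 * n). of_int (inv_sign (2 * n) p) * q ^ ldes (2 * n) p)
                 = (1 - q) * (\<Sum>p\<in>T n. q ^ (2 * ldes n p)))"
proof (intro conjI allI impI)
  have signed: "(\<Sum>p\<in>T m. of_int (inv_sign m p) * q ^ ldes m p) =
      (\<Sum>d<N. q ^ d * inv_count (- 1) m d)" if "m \<le> N" "0 < N" for m N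
    using sum_T_eq_sum_inv_count[OF that, of "\<lambda>d. q ^ d" "- 1"]
    by (simp add: inv_sign_def mult.commute)
  have unsigned: "(\<Sum>p\<in>T m. q ^ (2 * ldes m p)) = (\<Sum>d<N. q ^ (2 * d) * inv_count 1 m d)"
    if "m \<le> N" "0 < N" for m N
    using sum_T_eq_sum_inv_count[OF that, of "\<lambda>d. q ^ (2 * d)" 1] by simp
  fix n :: nat
  show "(\<Sum>p\<in>T (2 * n + 1). of_int (inv_sign (2 * n + 1) p) * q ^ ldes (2 * n + 1) p)
                 = (\<Sum>p\<in>T n. q ^ (2 * ldes n p))"
  proof -
    have "(\<Sum>p\<in>T (2 * n + 1). of_int (inv_sign (2 * n + 1) p) * q ^ ldes (2 * n + 1) p) =
      (\<Sum>d<2 * Suc n. q ^ d * inv_count (- 1) (2 * n + 1) d)"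
      by (rule signed) auto
    also have "\<dots> = (\<Sum>d<Suc n. q ^ (2 * d) * inv_count 1 n d)"
      unfolding sum_lessThan_double
      by (intro sum.cong refl)
        (simp only: signed_count(1,2)[OF refl] lessThan_iff less_Suc_eq_le mult_zero_right add_0_right)
    also have "\<dots> = (\<Sum>p\<in>T n. q ^ (2 * ldes n p))" by (rule unsigned[symmetric]) auto
    finally show ?thesis .
  qed
  assume n: "1 \<le> n"
  show "(\<Sum>p\<in>T (2 * n). of_int (inv_sign (2 * n) p) * q ^ ldes (2 * n) p)
                 = (1 - q) * (\<Sum>p\<in>T n. q ^ (2 * ldes n p))"
  proof -
    have "(\<Sum>p\<in>T (2 * n). of_int (inv_sign (2 * n) p) * q ^ ldes (2 * n) p) =
      (\<Sum>d<2 * n. q ^ d * inv_count (- 1) (2 * n) d)" by (rule signed) (use n in auto)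
    also have "\<dots> = (\<Sum>d<n. (1 - q) * (q ^ (2 * d) * inv_count 1 n d))"
      unfolding sum_lessThan_double
    proof (rule sum.cong[OF refl])
      fix d assume "d \<in> {..<n}"
      then have "d \<le> n" by simp
      then have "inv_count (- 1) (2 * n) (2 * d) = (inv_count 1 n d :: int poly)"
        and "inv_count (- 1) (2 * n) (2 * d + 1) = - (inv_count 1 n d :: int poly)"
        using signed_count(3,4)[OF refl _ n] by blast+
      then show "q ^ (2 * d) * inv_count (- 1) (2 * n) (2 * d) +
          q ^ (2 * d + 1) * inv_count (- 1) (2 * n) (2 * d + 1) =
          (1 - q) * (q ^ (2 * d) * inv_count 1 n d)"
        by (simp only: power_add power_one_right) (simp only: algebra_simps)
    qed
    also have "\<dots> = (1 - q) * (\<Sum>p\<in>T n. q ^ (2 * ldes n p))"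
      using n by (simp only: sum_distrib_left[symmetric] unsigned[of n n])
    finally show ?thesis .
  qed
qed

end
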